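(* Let $\bm{X}_E$ be a random vector in $\mathbb{R}^d_+$ with standard exponential margins and let $\bm{X}_E^1,\bm{X}_E^2,\ldots$ be independent copies of $\bm{X}_E$. Suppose that the sample cloud $N_n=\{\bm{X}_E^1/\log n,\ldots,\bm{X}_E^n/\log n\}$ converges in probability onto a limit set $G=\{\bm{x}\in\mathbb{R}^d_+:g(\bm{x})\le1\}$ with continuous gauge function $g$, and that for each $\bm{\omega}\in\mathcal{S}_\Sigma=\{\bm{\omega}\in[0,1]^d:\sum_{j=1}^d\omega_j=1\}$, $$\mathbb{P}(\bm{X}_E>\bm{\omega}v)=\ell(e^v;\bm{\omega})\,e^{-\lambda(\bm{\omega})v},$$ where $\ell(\cdot;\bm{\omega})$ is slowly varying at infinity and $\lambda(\bm{\omega})\in[0,\infty)$. Let $$R_{\bm{\omega}}=\prod_{j=1}^d\left(\frac{\omega_j}{\max(\bm{\omega})},\infty\right],\qquad r_{\bm{\omega}}=\min\{r\in[0,1]:rR_{\bm{\omega}}\cap G=\emptyset\},$$ $$B_{\bm{\omega}}=\bigcup_{i=1}^d\{\bm{x}\in\mathbb{R}^d_+:x_i=\omega_i/\max(\bm{\omega}),\ x_j\ge\omega_j/\max(\bm{\omega}),\ j\ne i\}.$$ Then $$r_{\bm{\omega}}=\Big[\min_{\bm{y}\in B_{\bm{\omega}}}g(\bm{y})\Big]^{-1},\qquad\text{and hence}\qquad \lambda(\bm{\omega})=\max(\bm{\omega})\times\min_{\bm{y}\in B_{\bm{\omega}}}g(\bm{y}).$$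
   Context: A sequence of random non-empty compact sets $N_n\subset\mathbb{R}^d$ converges in probability onto a deterministic non-empty compact set $G$ (the limit set) if $d_H(N_n,G)\to0$ in probability, where $d_H$ is the Hausdorff distance. The gauge function of $G$ is $g(\bm{x})=\inf\{t\ge0:\bm{x}\in tG\}$ for $\bm{x}\in\mathbb{R}^d_+=[0,\infty)^d$; it satisfies $g(t\bm{x})=tg(\bm{x})$ for $t>0$. A function $\ell:\mathbb{R}_+\to\mathbb{R}_+$ is slowly varying at infinity if $\ell(tx)/\ell(t)\to1$ as $t\to\infty$ for every $x>0$. Inequalities between vectors are componentwise, $\max(\bm{\omega})=\max_j\omega_j$, and $rR_{\bm{\omega}}=\prod_j(r\omega_j/\max(\bm{\omega}),\infty]$. *)

theory Defs
  imports "HOL-Probability.Probability"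
begin

definition orthant :: "(real ^ 'd) set" where
  "orthant = {x. \<forall>j. 0 \<le> x $ j}"

definition vec_max :: "real ^ 'd \<Rightarrow> real" where
  "vec_max w = Max (range (\<lambda>j. w $ j))"

definition sum_simplex :: "(real ^ 'd) set" where
  "sum_simplex = {w. (\<forall>j. w $ j \<in> {0..1}) \<and> (\<Sum>j\<in>UNIV. w $ j) = 1}"

text \<open>For non-empty bounded sets; the suprema are junk otherwise.\<close>

definition hausdorff_dist :: "'a::metric_space set \<Rightarrow> 'a set \<Rightarrow> real" where
  "hausdorff_dist A B = max (SUP a\<in>A. infdist a B) (SUP b\<in>B. infdist b A)"

text \<open>If \<open>N n\<close> is the set of values of finitely many (at least one) random vectors and \<open>G\<close> is
  compact and non-empty, then the Hausdorff distance is a random variable, so that the events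
  below are measurable.\<close>

definition converges_in_prob_onto ::
    "'s measure \<Rightarrow> (nat \<Rightarrow> 's \<Rightarrow> 'a::metric_space set) \<Rightarrow> 'a set \<Rightarrow> bool" where
  "converges_in_prob_onto M N G \<longleftrightarrow>
     (\<forall>e>0. (\<lambda>n. measure M {s \<in> space M. e < hausdorff_dist (N n s) G}) \<longlonglongrightarrow> 0)"

definition sample_cloud :: "(nat \<Rightarrow> 's \<Rightarrow> real ^ 'd) \<Rightarrow> nat \<Rightarrow> 's \<Rightarrow> (real ^ 'd) set" where
  "sample_cloud Xs n s = (\<lambda>i. Xs i s /\<^sub>R ln (real n)) ` {1..n}"

text \<open>Valued in \<open>ereal\<close>, so that the infimum over the empty set is \<open>\<infinity>\<close>.\<close>

definition gauge_fun :: "(real ^ 'd) set \<Rightarrow> real ^ 'd \<Rightarrow> ereal" where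
  "gauge_fun G x = (INF t\<in>{t. 0 \<le> t \<and> x \<in> (\<lambda>y. t *\<^sub>R y) ` G}. ereal t)"

definition slowly_varying :: "(real \<Rightarrow> real) \<Rightarrow> bool" where
  "slowly_varying l \<longleftrightarrow>
     (\<forall>t\<ge>0. 0 \<le> l t) \<and> (\<forall>x>0. ((\<lambda>t. l (t * x) / l t) \<longlongrightarrow> 1) at_top)"

text \<open>\<open>scaled_R r w\<close> is the product of the intervals \<open>(r w\<^sub>j / max w, \<infinity>]\<close>; in \<open>ereal\<close> the
  interval \<open>{a<..}\<close> contains \<open>\<infinity>\<close>.\<close>

definition scaled_R :: "real \<Rightarrow> real ^ 'd \<Rightarrow> (ereal ^ 'd) set" where
  "scaled_R r w = {x. \<forall>j. x $ j \<in> {ereal (r * w $ j / vec_max w) <..}}"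

definition ereal_vec :: "real ^ 'd \<Rightarrow> ereal ^ 'd" where
  "ereal_vec x = (\<chi> j. ereal (x $ j))"

definition B_set :: "real ^ 'd \<Rightarrow> (real ^ 'd) set" where
  "B_set w = (\<Union>i. {x \<in> orthant. x $ i = w $ i / vec_max w \<and>
                        (\<forall>j. j \<noteq> i \<longrightarrow> w $ j / vec_max w \<le> x $ j)})"

definition has_minimum :: "'a::linorder set \<Rightarrow> bool" where
  "has_minimum S \<longleftrightarrow> (\<exists>m\<in>S. \<forall>x\<in>S. m \<le> x)"

text \<open>Meaningful only if \<open>has_minimum S\<close>.\<close>

definition minimum :: "'a::linorder set \<Rightarrow> 'a" where
  "minimum S = (LEAST x. x \<in> S)"

definition avoiding_radii :: "(real ^ 'd) set \<Rightarrow> real ^ 'd \<Rightarrow> real set" where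
  "avoiding_radii G w = {r \<in> {0..1}. scaled_R r w \<inter> ereal_vec ` G = {}}"

definition r_min :: "(real ^ 'd) set \<Rightarrow> real ^ 'd \<Rightarrow> real" where
  "r_min G w = minimum (avoiding_radii G w)"

end

theory Submission
  imports Defs "HOL-Real_Asymp.Real_Asymp"
begin

text \<open>Write \<open>m = max w\<close> and \<open>c = min g\<close> over \<open>B\<^sub>w\<close>. By homogeneity points of \<open>rR\<^sub>w\<close> have gauge
  above \<open>r c\<close>, and \<open>r c\<close> is the infimum, so \<open>rR\<^sub>w\<close> misses \<open>G\<close> exactly when \<open>r c \<ge> 1\<close>. Each point of the scaled
  sample lies in \<open>rR\<^sub>w\<close> with probability \<open>q\<^sub>n = P(X > w (r/m) ln n)\<close>, which is \<open>n\<close> to the power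
  \<open>- \<lambda> r / m\<close> up to subpolynomial factors. If \<open>r c < 1\<close>, the cloud hits \<open>rR\<^sub>w\<close> with probability tending to \<open>1\<close>,
  and the union bound keeps \<open>n q\<^sub>n\<close> away from \<open>0\<close>, so that \<open>\<lambda> r \<le> m\<close>. If \<open>r c > 1\<close>, then \<open>rR\<^sub>w\<close> has positive
  distance from \<open>G\<close>, so \<open>(1 - q\<^sub>n)^n\<close> tends to \<open>1\<close>, which keeps \<open>n q\<^sub>n\<close> bounded and gives
  \<open>\<lambda> r \<ge> m\<close>. Hence \<open>\<lambda> = m c\<close>. At the unit vectors the exponential margins force
  \<open>\<lambda> \<ge> 1\<close>, so that \<open>c \<ge> 1\<close> for every \<open>w\<close> and the radius \<open>1 / c\<close> lies in \<open>[0, 1]\<close>.\<close>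

section \<open>Tails of regular variation\<close>

text \<open>\<open>F\<close> may behave arbitrarily inside a unit interval, so the bound on the
  first interval is carried to \<open>v\<close> by subtracting 1 finitely often; \<open>k\<close>
  counts these steps.\<close>

lemma bounded_above_of_unit_step_decreasing:
  fixes F :: "real \<Rightarrow> real"
  assumes step: "\<And>v. V \<le> v \<Longrightarrow> F (v + 1) \<le> F v"
    and base: "\<And>v. V \<le> v \<Longrightarrow> v \<le> V + 1 \<Longrightarrow> F v \<le> C"
    and "V \<le> v"
  shows "F v \<le> C"
proof -
  have "F v \<le> C" if "V \<le> v" "v \<le> V + 1 + real k" for k v
    using that
  proof (induction k arbitrary: v)
    case 0
    then show ?case using base by simp
  next
    case (Suc k)
    show ?case
    proof (cases "v \<le> V + 1")
      case True
      then show ?thesis using base Suc by simp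
    next
      case False
      then have "F (v - 1) \<le> C" using Suc by simp
      moreover have "F v \<le> F (v - 1)" using step[of "v - 1"] False by simp
      ultimately show ?thesis by simp
    qed
  qed
  from this[of v "nat \<lceil>v - V\<rceil>"] \<open>V \<le> v\<close> show ?thesis
    by (simp add: add.commute) linarith
qed

text \<open>The tail along one ray, detached from any probability space.\<close>

locale regularly_varying_tail =
  fixes p l :: "real \<Rightarrow> real" and lam :: real
  assumes antimono: "\<And>u v. 0 \<le> u \<Longrightarrow> u \<le> v \<Longrightarrow> p v \<le> p u"
    and slow: "slowly_varying l"
    and tail: "\<And>v. 0 \<le> v \<Longrightarrow> p v = l (exp v) * exp (- lam * v)"
begin

text \<open>Slow variation with the factor e becomes, after substituting \<open>exp v\<close>, a
  statement about unit steps in \<open>v\<close>.\<close>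

lemma ratio_tendsto: "((\<lambda>v. l (exp (v + 1)) / l (exp v)) \<longlongrightarrow> 1) at_top"
proof -
  have "((\<lambda>t. l (t * exp 1) / l t) \<longlongrightarrow> 1) at_top"
    using slow unfolding slowly_varying_def by simp
  from filterlim_compose[OF this exp_at_top] show ?thesis
    by (simp add: exp_add)
qed

lemma nonneg: "0 \<le> l (exp v)"
  using slow by (simp add: slowly_varying_def)

text \<open>Potter-type bounds. Monotonicity of \<open>p\<close> replaces the uniform convergence theorem: it bounds
  \<open>p v * exp (a * v)\<close> on one unit interval, and the ratio limit propagates the bound by unit steps.\<close>

lemma upper_bound:
  assumes "a < lam"
  shows "\<exists>C V. \<forall>v\<ge>V. p v \<le> C * exp (- a * v)"
proof -
  have "eventually (\<lambda>v. l (exp (v + 1)) / l (exp v) < exp (lam - a)) at_top"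
    using ratio_tendsto by (rule order_tendstoD) (use assms in simp)
  moreover have "eventually (\<lambda>v. l (exp (v + 1)) / l (exp v) > 0) at_top"
    using ratio_tendsto by (rule order_tendstoD) simp
  ultimately have "eventually (\<lambda>v. l (exp (v + 1)) \<le> exp (lam - a) * l (exp v)) at_top"
  proof eventually_elim
    case (elim v)
    \<comment> \<open>Division by zero yields 0, so a positive ratio excludes
      \<open>l (exp v) = 0\<close>.\<close>
    then have "0 < l (exp v)" using nonneg[of v] by (metis div_by_0 less_le)
    then show ?case using elim by (simp add: field_simps)
  qed
  then obtain V0 where V0: "\<And>v. V0 \<le> v \<Longrightarrow> l (exp (v + 1)) \<le> exp (lam - a) * l (exp v)"
    by (auto simp: eventually_at_top_linorder)
  \<comment> \<open>The tail formula is available only for non-negative arguments, hence the 0 in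
    the maximum. The claim amounts to boundedness of the tilted tail \<open>F\<close> beyond
    \<open>V\<close>.\<close>
  define V where "V = max 0 V0"
  define F where "F v = p v * exp (a * v)" for v
  have F: "F v = l (exp v) * exp ((a - lam) * v)" if "0 \<le> v" for v
    unfolding F_def tail[OF that] by (simp add: exp_add[symmetric] algebra_simps)
  have "F (v + 1) \<le> F v" if "V \<le> v" for v
  proof -
    have "F (v + 1) = l (exp (v + 1)) * exp (a - lam) * exp ((a - lam) * v)"
      using that F[of "v + 1"] by (simp add: V_def exp_add[symmetric] algebra_simps)
    also have "\<dots> \<le> exp (lam - a) * l (exp v) * exp (a - lam) * exp ((a - lam) * v)"
      using V0[of v] that by (intro mult_right_mono) (auto simp: V_def)
    also have "\<dots> = (exp (lam - a) * exp (a - lam)) * (l (exp v) * exp ((a - lam) * v))"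
      by (simp add: algebra_simps)
    also have "\<dots> = F v"
      using that F[of v] by (simp add: V_def exp_add[symmetric])
    finally show ?thesis .
  qed
  moreover have "F v \<le> p V * exp (\<bar>a\<bar> * (V + 1))" if "V \<le> v" "v \<le> V + 1" for v
  proof -
    have "a * v \<le> \<bar>a\<bar> * (V + 1)"
      using that by (intro mult_mono) (auto simp: V_def)
    moreover have "0 \<le> p V" using tail[of V] nonneg by (simp add: V_def)
    ultimately show ?thesis
      unfolding F_def using antimono[of V v] that by (intro mult_mono) (auto simp: V_def)
  qed
  ultimately have *: "F v \<le> p V * exp (\<bar>a\<bar> * (V + 1))" if "V \<le> v" for v
    using bounded_above_of_unit_step_decreasing[of V F _ v] that by blast
  have "p v \<le> p V * exp (\<bar>a\<bar> * (V + 1)) * exp (- a * v)" if "V \<le> v" for v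
    using *[OF that] by (simp add: F_def exp_minus field_simps)
  then show ?thesis by blast
qed

text \<open>The same propagation, applied to the negative of the tilted tail. The constant is
  positive because ratios tending to 1 force \<open>l (exp v)\<close>, and with it the tail, to be
  positive for large \<open>v\<close>.\<close>

lemma lower_bound:
  assumes "lam < a"
  shows "\<exists>C>0. \<exists>V. \<forall>v\<ge>V. C * exp (- a * v) \<le> p v"
proof -
  have "eventually (\<lambda>v. l (exp (v + 1)) / l (exp v) > exp (lam - a)) at_top"
    using ratio_tendsto by (rule order_tendstoD) (use assms in simp)
  moreover have "eventually (\<lambda>v. l (exp (v + 1)) / l (exp v) > 0) at_top"
    using ratio_tendsto by (rule order_tendstoD) simp
  ultimately have
    "eventually (\<lambda>v. l (exp (v + 1)) \<ge> exp (lam - a) * l (exp v) \<and> 0 < l (exp v)) at_top"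
  proof eventually_elim
    case (elim v)
    then have "0 < l (exp v)" using nonneg[of v] by (metis div_by_0 less_le)
    then show ?case using elim by (simp add: field_simps)
  qed
  then obtain V0 where V0: "\<And>v. V0 \<le> v \<Longrightarrow> l (exp (v + 1)) \<ge> exp (lam - a) * l (exp v)"
    and l_pos: "\<And>v. V0 \<le> v \<Longrightarrow> 0 < l (exp v)"
    by (auto simp: eventually_at_top_linorder)
  define V where "V = max 0 V0"
  define F where "F v = p v * exp (a * v)" for v
  \<comment> \<open>On the first unit interval the decreasing \<open>p\<close> is smallest at the
    right end, and the exponent \<open>a * v\<close> is at least
    \<open>- |a| * (V + 1)\<close>.\<close>
  define C where "C = p (V + 1) * exp (- \<bar>a\<bar> * (V + 1))"
  have F: "F v = l (exp v) * exp ((a - lam) * v)" if "0 \<le> v" for v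
    unfolding F_def tail[OF that] by (simp add: exp_add[symmetric] algebra_simps)
  have "- F (v + 1) \<le> - F v" if "V \<le> v" for v
  proof -
    have "F v = (exp (lam - a) * exp (a - lam)) * (l (exp v) * exp ((a - lam) * v))"
      using that F[of v] by (simp add: V_def exp_add[symmetric])
    also have "\<dots> = exp (lam - a) * l (exp v) * exp (a - lam) * exp ((a - lam) * v)"
      by (simp add: algebra_simps)
    also have "\<dots> \<le> l (exp (v + 1)) * exp (a - lam) * exp ((a - lam) * v)"
      using V0[of v] that by (intro mult_right_mono) (auto simp: V_def)
    also have "\<dots> = F (v + 1)"
      using that F[of "v + 1"] by (simp add: V_def exp_add[symmetric] algebra_simps)
    finally show ?thesis by simp
  qed
  moreover have "- F v \<le> - C" if "V \<le> v" "v \<le> V + 1" for v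
  proof -
    have "(- a) * v \<le> \<bar>a\<bar> * (V + 1)"
      using that by (intro mult_mono) (auto simp: V_def)
    moreover have "0 \<le> p v" using tail[of v] nonneg that by (simp add: V_def)
    ultimately show ?thesis
      unfolding F_def C_def neg_le_iff_le using antimono[of v "V + 1"] that
      by (intro mult_mono) (auto simp: V_def)
  qed
  ultimately have *: "C \<le> F v" if "V \<le> v" for v
    using bounded_above_of_unit_step_decreasing[of V "\<lambda>v. - F v" "- C" v] that by auto
  have "C > 0"
    using l_pos[of "V + 1"] tail[of "V + 1"] by (simp add: C_def V_def)
  moreover have "C * exp (- a * v) \<le> p v" if "V \<le> v" for v
    using *[OF that] by (simp add: F_def exp_minus field_simps)
  ultimately show ?thesis by blast
qed

section \<open>Rate bounds from the size of n p(c ln n)\<close>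

text \<open>If \<open>lam * c > 1\<close>, an exponent \<open>a\<close> strictly between
  \<open>1 / c\<close> and \<open>lam\<close> bounds \<open>p (c * ln n)\<close> by a multiple of
  \<open>n powr (- a * c)\<close> with \<open>a * c > 1\<close>, so \<open>n * p (c * ln n)\<close>
  tends to 0. The value 1 / 2 stands for any positive constant.\<close>

lemma rate_le_one:
  assumes "0 < c" and ev: "eventually (\<lambda>n. 1 / 2 \<le> real n * p (c * ln (real n))) sequentially"
  shows "lam * c \<le> 1"
proof (rule ccontr)
  assume "\<not> lam * c \<le> 1"
  then have "1 / c < lam" using \<open>0 < c\<close> by (simp add: field_simps)
  then obtain a where a: "1 / c < a" "a < lam" using dense by blast
  then have ac: "a * c > 1" using \<open>0 < c\<close> by (simp add: field_simps)
  obtain C V where C: "\<And>v. V \<le> v \<Longrightarrow> p v \<le> C * exp (- a * v)"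
    using upper_bound[OF a(2)] by blast
  have lim: "filterlim (\<lambda>n. c * ln (real n)) at_top sequentially"
    using \<open>0 < c\<close> by real_asymp
  have "eventually (\<lambda>n. V \<le> c * ln (real n)) sequentially"
    using lim by (auto simp: filterlim_at_top)
  moreover have "(\<lambda>n. C * (real n * exp (- a * (c * ln (real n))))) \<longlonglongrightarrow> C * 0"
  proof (intro tendsto_intros)
    have "1 - a * c < 0" using ac by simp
    then have "(\<lambda>n. real n powr (1 - a * c)) \<longlonglongrightarrow> 0" by real_asymp
    moreover have "eventually (\<lambda>n. real n powr (1 - a * c) = real n * exp (- a * (c * ln (real n)))) sequentially"
      using eventually_gt_at_top[of 0]
      by eventually_elim (simp add: powr_def left_diff_distrib exp_diff exp_minus divide_inverse mult.assoc)
    ultimately show "(\<lambda>n. real n * exp (- a * (c * ln (real n)))) \<longlonglongrightarrow> 0"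
      by (rule Lim_transform_eventually)
  qed
  then have "eventually (\<lambda>n. C * (real n * exp (- a * (c * ln (real n)))) < 1 / 2) sequentially"
    by (rule order_tendstoD) simp
  ultimately have "eventually (\<lambda>n::nat. False) sequentially"
    using ev
  proof eventually_elim
    case (elim n)
    have "real n * p (c * ln (real n)) \<le> real n * (C * exp (- a * (c * ln (real n))))"
      by (intro mult_left_mono C elim) simp
    then show ?case using elim by (simp add: algebra_simps)
  qed
  then show False by simp
qed

text \<open>If \<open>lam * c < 1\<close>, the lower bound with \<open>a\<close> between
  \<open>lam\<close> and \<open>1 / c\<close> makes \<open>n * p (c * ln n)\<close> grow at least
  like a positive power of \<open>n\<close>.\<close>

lemma rate_ge_one:
  assumes "0 < c" and ev: "eventually (\<lambda>n. real n * p (c * ln (real n)) \<le> 1) sequentially"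
  shows "1 \<le> lam * c"
proof (rule ccontr)
  assume "\<not> 1 \<le> lam * c"
  then have "lam < 1 / c" using \<open>0 < c\<close> by (simp add: field_simps)
  then obtain a where a: "lam < a" "a < 1 / c" using dense by blast
  then have ac: "a * c < 1" using \<open>0 < c\<close> by (simp add: field_simps)
  obtain C V where C: "C > 0" "\<And>v. V \<le> v \<Longrightarrow> C * exp (- a * v) \<le> p v"
    using lower_bound[OF a(1)] by blast
  have lim: "filterlim (\<lambda>n. c * ln (real n)) at_top sequentially"
    using \<open>0 < c\<close> by real_asymp
  have "eventually (\<lambda>n. V \<le> c * ln (real n)) sequentially"
    using lim by (auto simp: filterlim_at_top)
  moreover have "filterlim (\<lambda>n. C * real n powr (1 - a * c)) at_top sequentially"
  proof -
    have "1 - a * c > 0" using ac by simp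
    then show ?thesis using \<open>C > 0\<close> by real_asymp
  qed
  then have "eventually (\<lambda>n. 1 < C * real n powr (1 - a * c)) sequentially"
    by (auto simp: filterlim_at_top_dense)
  ultimately have "eventually (\<lambda>n::nat. False) sequentially"
    using ev eventually_gt_at_top[of 0]
  proof eventually_elim
    case (elim n)
    have "real n * (C * exp (- a * (c * ln (real n)))) \<le> real n * p (c * ln (real n))"
      by (intro mult_left_mono C elim) simp
    moreover have "real n powr (1 - a * c) = real n * exp (- a * (c * ln (real n)))"
      using elim by (simp add: powr_def left_diff_distrib exp_diff exp_minus divide_inverse mult.assoc)
    ultimately show ?case using elim by (simp only: mult.left_commute)
  qed
  then show False by simp
qed

end

section \<open>Sample clouds near a limit set\<close>

lemma bdd_above_image_compact:
  fixes f :: "'a::topological_space \<Rightarrow> real"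
  assumes "compact S" "continuous_on S f"
  shows "bdd_above (f ` S)"
  using assms by (intro bounded_imp_bdd_above compact_imp_bounded compact_continuous_image)

lemma infdist_le_hausdorff_dist:
  assumes "finite A" "a \<in> A"
  shows "infdist a B \<le> hausdorff_dist A B"
proof -
  have "infdist a B \<le> (SUP a\<in>A. infdist a B)"
    using assms by (intro cSUP_upper bdd_above_finite) auto
  then show ?thesis by (simp add: hausdorff_dist_def)
qed

text \<open>The distance to a finite set is attained, and compactness of \<open>B\<close> makes the
  supremum over \<open>B\<close> a genuine upper bound.\<close>

lemma obtains_near_hausdorff_dist:
  fixes A B :: "'a::metric_space set"
  assumes "finite A" "A \<noteq> {}" "compact B" "b \<in> B"
  obtains a where "a \<in> A" "dist b a \<le> hausdorff_dist A B"
proof -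
  have "Min (dist b ` A) \<in> dist b ` A"
    using assms by (intro Min_in) auto
  then obtain a where "a \<in> A" "Min (dist b ` A) = dist b a" by blast
  moreover have "infdist b A = Min (dist b ` A)"
    using assms by (simp add: infdist_notempty cInf_eq_Min)
  moreover have "infdist b A \<le> (SUP b\<in>B. infdist b A)"
    using assms by (intro cSUP_upper bdd_above_image_compact continuous_intros) auto
  ultimately show thesis using that by (force simp: hausdorff_dist_def)
qed

section \<open>Measurability of the Hausdorff distance\<close>

text \<open>Restricting \<open>b\<close> to a dense subset, which may be taken countable, gives measurability.\<close>

lemma less_hausdorff_dist_iff:
  assumes "finite A" "A \<noteq> {}" "compact B" "B \<noteq> {}" 
    and D: "D \<subseteq> B" "B \<subseteq> closure D"
  shows "e < hausdorff_dist A B \<longleftrightarrow>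
    (\<exists>a\<in>A. e < infdist a B) \<or> (\<exists>b\<in>D. \<forall>a\<in>A. e < dist b a)"
proof -
  have "bdd_above ((\<lambda>b. infdist b A) ` B)"
    using assms by (intro bdd_above_image_compact continuous_intros)
  then have "e < hausdorff_dist A B \<longleftrightarrow>
      (\<exists>a\<in>A. e < infdist a B) \<or> (\<exists>b\<in>B. e < infdist b A)"
    using assms unfolding hausdorff_dist_def less_max_iff_disj
    by (subst (1 2) less_cSUP_iff) auto
  also have "(\<exists>b\<in>B. e < infdist b A) \<longleftrightarrow> (\<exists>b\<in>D. e < infdist b A)"
  proof
    assume "\<exists>b\<in>B. e < infdist b A"
    then obtain b where b: "b \<in> B" "e < infdist b A" by blast
    \<comment> \<open>An open set that meets the closure of \<open>D\<close> meets \<open>D\<close>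
      itself.\<close>
    have "open {b. e < infdist b A}"
      by (intro open_Collect_less continuous_intros)
    moreover have "b \<in> closure D" using b D by blast
    ultimately show "\<exists>b\<in>D. e < infdist b A"
      using b(2) open_Int_closure_eq_empty[of "{b. e < infdist b A}" D] by blast
  qed (use D in blast)
  also have "(\<lambda>b. e < infdist b A) = (\<lambda>b. \<forall>a\<in>A. e < dist b a)"
    using assms by (simp add: infdist_notempty finite_less_Inf_iff)
  finally show ?thesis .
qed

context prob_space
begin

text \<open>Separability makes the union over points of \<open>G\<close> countable, and the cloud
  contributes finite unions and intersections. Since \<open>measure\<close> is 0 on non-measurable
  sets, this is what justifies passing to complements of these events.\<close>

lemma hausdorff_dist_event:
  fixes Y :: "'i \<Rightarrow> 'a \<Rightarrow> 'b::{metric_space, second_countable_topology}"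
  assumes "finite I" "I \<noteq> {}" "\<And>i. i \<in> I \<Longrightarrow> random_variable borel (Y i)"
    and "compact G" "G \<noteq> {}"
  shows "{s \<in> space M. e < hausdorff_dist ((\<lambda>i. Y i s) ` I) G} \<in> events"
proof -
  obtain D :: "'b set" where D: "countable D" "D \<subseteq> G" "G \<subseteq> closure D" using separable by blast
  have [measurable]: "(\<lambda>x. infdist x G) \<in> borel_measurable borel" for G :: "'b set"
    by (intro borel_measurable_continuous_onI continuous_intros)
  have [measurable]: "random_variable borel (Y i)" if "i \<in> I" for i
    using assms(3)[OF that] .
  have "{s \<in> space M. e < hausdorff_dist ((\<lambda>i. Y i s) ` I) G} =
    (\<Union>i\<in>I. {s \<in> space M. e < infdist (Y i s) G}) \<union>
    (\<Union>b\<in>D. \<Inter>i\<in>I. {s \<in> space M. e < dist b (Y i s)})"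
    using assms D by (subst less_hausdorff_dist_iff[of _ G D]) auto
  also have "\<dots> \<in> events"
  proof (intro sets.Un)
    show "(\<Union>i\<in>I. {s \<in> space M. e < infdist (Y i s) G}) \<in> events"
      using assms(1) by (intro sets.finite_UN) measurable
    show "(\<Union>b\<in>D. \<Inter>i\<in>I. {s \<in> space M. e < dist b (Y i s)}) \<in> events"
      using assms(1,2) D(1) by (intro sets.countable_UN'' sets.finite_INT) measurable
  qed
  finally show ?thesis .
qed

end

section \<open>Hitting probabilities of a convergent cloud\<close>

text \<open>A triangular array: the dependence of \<open>Y n i\<close> on \<open>n\<close> absorbs
  the scaling by \<open>ln n\<close>. The cloud is empty for \<open>n = 0\<close>, so events are
  considered from \<open>n = 1\<close> on.\<close>

locale limit_cloud = prob_space M for M :: "'a measure" +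
  fixes Y :: "nat \<Rightarrow> nat \<Rightarrow> 'a \<Rightarrow> 'b::{metric_space, second_countable_topology}"
    and G :: "'b set"
  assumes Y: "\<And>n i. 1 \<le> i \<Longrightarrow> random_variable borel (Y n i)"
    and G: "compact G" "G \<noteq> {}"
    and conv: "converges_in_prob_onto M (\<lambda>n s. (\<lambda>i. Y n i s) ` {1..n}) G"
begin

lemma close_event:
  assumes "1 \<le> n"
  shows "{s \<in> space M. e < hausdorff_dist ((\<lambda>i. Y n i s) ` {1..n}) G} \<in> events"
  using assms G by (intro hausdorff_dist_event Y) auto

lemma eventually_close:
  assumes "0 < e"
  shows "eventually (\<lambda>n. 1 / 2 \<le>
    prob {s \<in> space M. hausdorff_dist ((\<lambda>i. Y n i s) ` {1..n}) G \<le> e}) sequentially"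
proof -
  have "eventually (\<lambda>n. prob {s \<in> space M. e < hausdorff_dist ((\<lambda>i. Y n i s) ` {1..n}) G} < 1 / 2) sequentially"
    using conv assms unfolding converges_in_prob_onto_def by (intro order_tendstoD) auto
  then show ?thesis
    using eventually_ge_at_top[of 1]
  proof eventually_elim
    case (elim n)
    have "{s \<in> space M. hausdorff_dist ((\<lambda>i. Y n i s) ` {1..n}) G \<le> e} =
      space M - {s \<in> space M. e < hausdorff_dist ((\<lambda>i. Y n i s) ` {1..n}) G}" by auto
    then show ?case using elim prob_compl[OF close_event[of n e]] by simp
  qed
qed

text \<open>A cloud within \<open>e\<close> of \<open>G\<close> has a point in the ball of radius
  \<open>e\<close> around \<open>z\<close>, hence in \<open>A\<close>. The union bound then compares
  the probability of this event with \<open>n * q n\<close>.\<close>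

lemma mass_near_limit_point:
  assumes z: "z \<in> G" "z \<in> A" and A: "open A"
    and q: "eventually (\<lambda>n. \<forall>i\<in>{1..n}. prob {s \<in> space M. Y n i s \<in> A} = q n) sequentially"
  shows "eventually (\<lambda>n. 1 / 2 \<le> real n * q n) sequentially"
proof -
  obtain e where e: "e > 0" "cball z e \<subseteq> A"
    using A z(2) open_contains_cball by blast
  show ?thesis
    using eventually_close[OF e(1)] q eventually_ge_at_top[of 1]
  proof eventually_elim
    case (elim n)
    have ev: "{s \<in> space M. Y n i s \<in> A} \<in> events" if "i \<in> {1..n}" for i
    proof -
      have "Y n i -` A \<inter> space M \<in> events"
        using that A Y[of i n] by (intro measurable_sets[of "Y n i" M borel]) auto
      then show ?thesis by (simp add: vimage_def Int_def conj_commute)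
    qed
    have "{s \<in> space M. hausdorff_dist ((\<lambda>i. Y n i s) ` {1..n}) G \<le> e}
      \<subseteq> (\<Union>i\<in>{1..n}. {s \<in> space M. Y n i s \<in> A})"
    proof
      fix s assume s: "s \<in> {s \<in> space M. hausdorff_dist ((\<lambda>i. Y n i s) ` {1..n}) G \<le> e}"
      obtain a where "a \<in> (\<lambda>i. Y n i s) ` {1..n}" "dist z a \<le> hausdorff_dist ((\<lambda>i. Y n i s) ` {1..n}) G"
        using obtains_near_hausdorff_dist[of "(\<lambda>i. Y n i s) ` {1..n}" G z] elim(3) G z(1) by auto
      then show "s \<in> (\<Union>i\<in>{1..n}. {s \<in> space M. Y n i s \<in> A})"
        using s e(2) by (force simp: subset_iff)
    qed
    then have "1 / 2 \<le> prob (\<Union>i\<in>{1..n}. {s \<in> space M. Y n i s \<in> A})"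
      using elim(1) ev by (meson order_trans finite_measure_mono sets.finite_UN finite_atLeastAtMost)
    also have "\<dots> \<le> (\<Sum>i\<in>{1..n}. prob {s \<in> space M. Y n i s \<in> A})"
      using ev by (intro finite_measure_subadditive_finite) auto
    also have "\<dots> = real n * q n" using elim(2) by simp
    finally show ?case .
  qed
qed

text \<open>A cloud within \<open>e\<close> of \<open>G\<close> misses \<open>A\<close> altogether.
  By independence this has probability \<open>(1 - q n) ^ n\<close>, at most
  \<open>exp (- n * q n)\<close>, and a value of at least 1 / 2 bounds
  \<open>n * q n\<close>.\<close>

lemma mass_away_from_limit_set:
  assumes indep: "\<And>n. indep_vars (\<lambda>_. borel) (Y n) {1..}"
    and A: "A \<in> sets borel" and e: "0 < e" "\<And>x. x \<in> A \<Longrightarrow> e < infdist x G"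
    and q: "eventually (\<lambda>n. \<forall>i\<in>{1..n}. prob {s \<in> space M. Y n i s \<in> A} = q n) sequentially"
  shows "eventually (\<lambda>n. real n * q n \<le> 1) sequentially"
  using eventually_close[OF e(1)] q eventually_ge_at_top[of 1]
proof eventually_elim
  case (elim n)
  have q01: "0 \<le> q n" "q n \<le> 1"
    using elim(2,3) measure_nonneg prob_le_1 by (metis atLeastAtMost_iff order_refl)+
  have ev: "Y n i -` (- A) \<inter> space M \<in> events" if "i \<in> {1..n}" for i
    using that A Y[of i n] by (intro measurable_sets[of "Y n i" M borel]) auto
  have compl: "prob (Y n i -` (- A) \<inter> space M) = 1 - q n" if "i \<in> {1..n}" for i
  proof -
    have "{s \<in> space M. Y n i s \<in> A} = Y n i -` A \<inter> space M" by auto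
    moreover have "Y n i -` A \<inter> space M \<in> events"
      using that A Y[of i n] by (intro measurable_sets[of "Y n i" M borel]) auto
    moreover have "Y n i -` (- A) \<inter> space M = space M - (Y n i -` A \<inter> space M)" by auto
    ultimately show ?thesis using elim(2) that prob_compl by metis
  qed
  have "{s \<in> space M. hausdorff_dist ((\<lambda>i. Y n i s) ` {1..n}) G \<le> e}
      \<subseteq> (\<Inter>i\<in>{1..n}. Y n i -` (- A) \<inter> space M)"
  proof
    fix s assume s: "s \<in> {s \<in> space M. hausdorff_dist ((\<lambda>i. Y n i s) ` {1..n}) G \<le> e}"
    have "Y n i s \<notin> A" if "i \<in> {1..n}" for i
    proof -
      have "infdist (Y n i s) G \<le> hausdorff_dist ((\<lambda>i. Y n i s) ` {1..n}) G"
        using that by (intro infdist_le_hausdorff_dist) auto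
      then show ?thesis using s e(2) by fastforce
    qed
    then show "s \<in> (\<Inter>i\<in>{1..n}. Y n i -` (- A) \<inter> space M)" using s by auto
  qed
  moreover have "(\<Inter>i\<in>{1..n}. Y n i -` (- A) \<inter> space M) \<in> events"
    using elim(3) ev by (intro sets.finite_INT) auto
  ultimately have "1 / 2 \<le> prob (\<Inter>i\<in>{1..n}. Y n i -` (- A) \<inter> space M)"
    using elim(1) finite_measure_mono order_trans by blast
  also have "\<dots> = (\<Prod>i\<in>{1..n}. prob (Y n i -` (- A) \<inter> space M))"
    using elim(3) A by (intro indep_varsD[OF indep]) auto
  also have "\<dots> = (1 - q n) ^ n" using compl by simp
  also have "\<dots> \<le> exp (- q n) ^ n"
    using q01 exp_ge_add_one_self[of "- q n"] by (intro power_mono) auto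
  also have "\<dots> = exp (- (real n * q n))" by (simp add: exp_of_nat_mult[symmetric])
  finally have "exp (real n * q n) \<le> 2" by (simp add: exp_minus field_simps)
  \<comment> \<open>With \<open>x = n * q n\<close>, the inequality
    \<open>1 + x <= exp x <= 2\<close> gives \<open>x <= 1\<close>.\<close>
  then show ?case using exp_ge_add_one_self[of "real n * q n"] by linarith
qed

end

section \<open>Gauges and radii\<close>

lemma minimum_eqI:
  assumes "m \<in> S" "\<And>x. x \<in> S \<Longrightarrow> m \<le> x"
  shows "has_minimum S" "minimum S = m"
  using assms by (auto simp: has_minimum_def minimum_def intro: Least_equality)

lemma open_upper_orthant: "open {x :: real ^ 'd. \<forall>j. a j < x $ j}"
proof -
  have "{x :: real ^ 'd. \<forall>j. a j < x $ j} = (\<Inter>j. {x. a j < x $ j})" by auto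
  also have "open \<dots>" by (intro open_INT ballI open_Collect_less continuous_intros) simp
  finally show ?thesis .
qed

lemma closed_upper_orthant: "closed {x :: real ^ 'd. \<forall>j. a j \<le> x $ j}"
  by (intro closed_Collect_all closed_Collect_le continuous_intros)

lemma sum_simplexD:
  fixes w :: "real ^ 'd"
  assumes "w \<in> sum_simplex"
  shows "0 \<le> w $ j" "w $ j \<le> vec_max w" "0 < vec_max w" "\<exists>k. w $ k = vec_max w"
proof -
  show nn: "0 \<le> w $ j" for j using assms by (simp add: sum_simplex_def)
  show le: "w $ j \<le> vec_max w" for j by (simp add: vec_max_def)
  have "vec_max w \<in> range (($) w)" unfolding vec_max_def by (intro Max_in) auto
  then show "\<exists>k. w $ k = vec_max w" by auto
  have "\<exists>j. w $ j \<noteq> 0"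
  proof (rule ccontr)
    assume "\<nexists>j. w $ j \<noteq> 0"
    then show False using assms by (simp add: sum_simplex_def)
  qed
  then show "0 < vec_max w" using nn le by (metis less_le_trans less_le)
qed

text \<open>The set is the boundary of the closed upper orthant with corner
  \<open>w / vec_max w\<close>. The corner is non-negative, so the coordinate bounds already imply
  membership in \<open>orthant\<close>.\<close>

lemma mem_B_set_iff:
  fixes w :: "real ^ 'd"
  assumes "w \<in> sum_simplex"
  shows "y \<in> B_set w \<longleftrightarrow>
    (\<forall>j. w $ j / vec_max w \<le> y $ j) \<and> (\<exists>i. y $ i = w $ i / vec_max w)"
proof -
  have "0 \<le> w $ j / vec_max w" for j using sum_simplexD[OF assms] by (simp add: less_imp_le)
  then show ?thesis
    unfolding B_set_def orthant_def by (auto, metis order_refl, metis order_trans)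
qed

lemma closed_B_set:
  fixes w :: "real ^ 'd"
  assumes "w \<in> sum_simplex"
  shows "closed (B_set w)"
proof -
  have "B_set w = {y. \<forall>j. w $ j / vec_max w \<le> y $ j} \<inter> (\<Union>i. {y. y $ i = w $ i / vec_max w})"
    using mem_B_set_iff[OF assms] by auto
  also have "closed \<dots>"
    by (intro closed_Int closed_upper_orthant closed_UN ballI closed_Collect_eq continuous_intros) simp
  finally show ?thesis .
qed

section \<open>Geometry of a homogeneous gauge on the orthant\<close>

text \<open>A real-valued gauge is easier to compute with than an extended one; \<open>g\<close> is
  unconstrained off the orthant.\<close>

locale gauge_body =
  fixes G :: "(real ^ 'd) set" and g :: "real ^ 'd \<Rightarrow> real"
  assumes mem_iff: "x \<in> G \<longleftrightarrow> x \<in> orthant \<and> g x \<le> 1"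
    and homogeneous: "x \<in> orthant \<Longrightarrow> 0 < t \<Longrightarrow> g (t *\<^sub>R x) = t * g x"
    and pos: "x \<in> orthant \<Longrightarrow> x \<noteq> 0 \<Longrightarrow> 0 < g x"
    and cont: "continuous_on orthant g"
    and compact_G: "compact G"
begin

text \<open>\<open>B_set w\<close> is closed but may be unbounded. With \<open>c\<close> the gauge
  of its corner \<open>u\<close>, the points of gauge at most \<open>c\<close> are those in the
  compact dilate of \<open>G\<close> by \<open>c\<close>; a minimum over them is global.\<close>

lemma obtains_minimizer:
  assumes w: "w \<in> sum_simplex"
  obtains y where "y \<in> B_set w" "\<And>z. z \<in> B_set w \<Longrightarrow> g y \<le> g z" "0 < g y"
proof -
  note w' = sum_simplexD[OF w]
  have orth: "z \<in> orthant" "z \<noteq> 0" if "z \<in> B_set w" for z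
  proof -
    have *: "w $ j / vec_max w \<le> z $ j" for j using that mem_B_set_iff[OF w] by blast
    have "0 \<le> w $ j / vec_max w" for j using w'(1,3) by (simp add: less_imp_le)
    then show "z \<in> orthant" unfolding orthant_def using * order_trans by blast
    obtain k where "w $ k = vec_max w" using w'(4) by blast
    then have "1 \<le> z $ k" using *[of k] w'(3) by simp
    then show "z \<noteq> 0" by auto
  qed
  define u where "u = (\<chi> j. w $ j / vec_max w)"
  have u: "u \<in> B_set w" by (simp add: mem_B_set_iff[OF w] u_def)
  define c where "c = g u"
  have c: "0 < c" unfolding c_def using orth[OF u] by (intro pos)
  have mem: "z \<in> (*\<^sub>R) c ` G \<longleftrightarrow> g z \<le> c" if "z \<in> B_set w" for z
  proof -
    have *: "inverse c *\<^sub>R z \<in> G \<longleftrightarrow> g z \<le> c"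
    proof -
      have "inverse c *\<^sub>R z \<in> orthant" using orth[OF that] c by (auto simp: orthant_def)
      moreover have "g (inverse c *\<^sub>R z) = inverse c * g z"
        using orth[OF that] c by (intro homogeneous) auto
      moreover have "inverse c * g z \<le> 1 \<longleftrightarrow> g z \<le> c" using c by (simp add: field_simps)
      ultimately show ?thesis by (simp only: mem_iff simp_thms)
    qed
    show ?thesis
    proof
      assume "z \<in> (*\<^sub>R) c ` G"
      then have "inverse c *\<^sub>R z \<in> G" using c by auto
      then show "g z \<le> c" using * by simp
    next
      assume "g z \<le> c"
      then show "z \<in> (*\<^sub>R) c ` G" using * c by (intro image_eqI[of _ _ "inverse c *\<^sub>R z"]) auto
    qed
  qed
  define K where "K = B_set w \<inter> (*\<^sub>R) c ` G"
  have "compact K"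
    unfolding K_def using closed_B_set[OF w] compact_scaling[OF compact_G, of c]
    by (intro closed_Int_compact)
  moreover have "K \<noteq> {}" using u mem[OF u] unfolding K_def c_def by blast
  moreover have "continuous_on K g"
    using cont orth(1) unfolding K_def by (blast intro: continuous_on_subset)
  ultimately obtain y where y: "y \<in> K" "\<And>z. z \<in> K \<Longrightarrow> g y \<le> g z"
    using continuous_attains_inf[of K g] by auto
  then have yB: "y \<in> B_set w" by (simp add: K_def)
  have "g y \<le> g z" if "z \<in> B_set w" for z
  proof (cases "g z \<le> c")
    case True
    then show ?thesis using y(2) mem[OF that] that by (simp add: K_def)
  next
    case False
    moreover have "g y \<le> c" using y(1) mem[OF yB] by (simp add: K_def)
    ultimately show ?thesis by simp
  qed
  then show thesis using that[of y] yB pos[OF orth[OF yB]] by blast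
qed

text \<open>The ray through \<open>x\<close> meets \<open>B_set w\<close> at \<open>x / t\<close>,
  where \<open>t\<close> is the smallest ratio of a coordinate of \<open>x\<close> to that of the
  corner. Homogeneity transfers the bound \<open>c\<close> from there to \<open>x\<close>.\<close>

lemma radial_lower_bound:
  assumes w: "w \<in> sum_simplex" and y: "\<And>z. z \<in> B_set w \<Longrightarrow> c \<le> g z"
    and x: "x \<in> orthant" "\<And>j. 0 < w $ j \<Longrightarrow> 0 < x $ j"
  obtains i where "0 < w $ i" "x $ i / (w $ i / vec_max w) * c \<le> g x"
proof -
  note w' = sum_simplexD[OF w]
  define u where "u j = w $ j / vec_max w" for j
  have u: "0 \<le> u j" "0 < u j \<longleftrightarrow> 0 < w $ j" for j
    using w'(1,3) by (simp_all add: u_def less_imp_le zero_less_divide_iff)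
  \<comment> \<open>Where \<open>w $ j = 0\<close> the corner coordinate vanishes and the constraint
    is mere non-negativity, so the minimum runs over the remaining indices.\<close>
  define J where "J = {j. 0 < w $ j}"
  obtain k where "w $ k = vec_max w" using w'(4) by blast
  then have "k \<in> J" using w'(3) by (simp add: J_def)
  then have "Min ((\<lambda>j. x $ j / u j) ` J) \<in> (\<lambda>j. x $ j / u j) ` J" by (intro Min_in) auto
  then obtain i where i: "i \<in> J" "Min ((\<lambda>j. x $ j / u j) ` J) = x $ i / u i" by auto
  define t where "t = x $ i / u i"
  have t: "t \<le> x $ j / u j" if "j \<in> J" for j
    using that unfolding t_def i(2)[symmetric] by simp
  have tpos: "0 < t" using i(1) u(2)[of i] x(2)[of i] by (simp add: t_def J_def)
  have "inverse t *\<^sub>R x \<in> B_set w"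
    unfolding mem_B_set_iff[OF w] u_def[symmetric]
  proof (intro conjI allI exI[of _ i])
    fix j
    show "u j \<le> (inverse t *\<^sub>R x) $ j"
    proof (cases "j \<in> J")
      case True
      then show ?thesis using t[OF True] tpos u(2)[of j] by (simp add: J_def field_simps)
    next
      case False
      then have "u j = 0" using u[of j] by (simp add: J_def)
      then show ?thesis using x(1) tpos by (simp add: orthant_def)
    qed
    show "(inverse t *\<^sub>R x) $ i = u i"
      using i(1) u(2)[of i] x(2)[of i] by (simp add: t_def J_def field_simps)
  qed
  then have "c \<le> g (inverse t *\<^sub>R x)" by (rule y)
  also have "\<dots> = inverse t * g x" using x(1) tpos by (intro homogeneous) auto
  finally have "t * c \<le> g x" using tpos by (simp add: field_simps)
  then show thesis using that[of i] i(1) by (simp add: J_def t_def u_def)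
qed

text \<open>Every ratio of \<open>x $ i\<close> to the corner coordinate is at least
  \<open>r\<close>, in particular the one from the radial bound. The weak form serves the closed
  orthant at positive distance from \<open>G\<close>, the strict form the critical radius
  \<open>r = 1 / c\<close>.\<close>

lemma exceeds_radius:
  assumes w: "w \<in> sum_simplex" and y: "\<And>z. z \<in> B_set w \<Longrightarrow> c \<le> g z" and "0 < c" and "0 < r"
  shows "(\<And>j. r * w $ j / vec_max w \<le> x $ j) \<Longrightarrow> r * c \<le> g x"
    and "(\<And>j. r * w $ j / vec_max w < x $ j) \<Longrightarrow> r * c < g x"
proof -
  note w' = sum_simplexD[OF w]
  have nonneg: "0 \<le> r * w $ j / vec_max w" "0 < w $ j \<Longrightarrow> 0 < r * w $ j / vec_max w" for j
    using w'(1,3) \<open>0 < r\<close> by (simp_all add: less_imp_le)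
  have bound: thesis
    if "\<And>j. r * w $ j / vec_max w \<le> x $ j"
      and "\<And>i. 0 < w $ i \<Longrightarrow> x $ i / (w $ i / vec_max w) * c \<le> g x \<Longrightarrow> thesis" for thesis
  proof (rule radial_lower_bound[OF w y])
    show "x \<in> orthant"
      unfolding orthant_def using that(1) nonneg(1) order_trans by blast
    show "0 < x $ j" if "0 < w $ j" for j
      using \<open>\<And>j. r * w $ j / vec_max w \<le> x $ j\<close>[of j] nonneg(2)[OF that] by linarith
  qed (use that(2) in blast)+
  show "r * c \<le> g x" if *: "\<And>j. r * w $ j / vec_max w \<le> x $ j"
  proof (rule bound[OF *])
    fix i assume i: "0 < w $ i" "x $ i / (w $ i / vec_max w) * c \<le> g x"
    have "r \<le> x $ i / (w $ i / vec_max w)" using *[of i] i(1) w'(3) by (simp add: field_simps)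
    then have "r * c \<le> x $ i / (w $ i / vec_max w) * c" using \<open>0 < c\<close> by (intro mult_right_mono) auto
    then show "r * c \<le> g x" using i(2) by linarith
  qed
  show "r * c < g x" if *: "\<And>j. r * w $ j / vec_max w < x $ j"
  proof (rule bound[OF less_imp_le[OF *]])
    fix i assume i: "0 < w $ i" "x $ i / (w $ i / vec_max w) * c \<le> g x"
    have "r < x $ i / (w $ i / vec_max w)" using *[of i] i(1) w'(3) by (simp add: field_simps)
    then have "r * c < x $ i / (w $ i / vec_max w) * c" using \<open>0 < c\<close> by (intro mult_strict_right_mono) auto
    then show "r * c < g x" using i(2) by linarith
  qed
qed

text \<open>A slight shift of \<open>y\<close> keeps \<open>r * g < 1\<close> by continuity;
  rescaling the shifted point to gauge 1 then lifts it above the corner of the orthant of radius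
  \<open>r\<close>.\<close>

lemma exists_above_radius:
  assumes w: "w \<in> sum_simplex" and y: "y \<in> B_set w" and r: "0 \<le> r" "r * g y < 1"
  shows "\<exists>z\<in>G. \<forall>j. r * w $ j / vec_max w < z $ j"
proof -
  note w' = sum_simplexD[OF w]
  \<comment> \<open>\<open>y\<close> is moved into the open orthant because \<open>w $ j\<close> and \<open>y $ j\<close> may both vanish.\<close>
  define e where "e n = (\<chi> j. y $ j + 1 / real (Suc n))" for n
  have y_ge: "w $ j / vec_max w \<le> y $ j" for j using y mem_B_set_iff[OF w] by blast
  moreover have u: "0 \<le> w $ j / vec_max w" for j using w'(1,3) by (simp add: less_imp_le)
  ultimately have y_nn: "0 \<le> y $ j" for j by (meson order_trans)
  then have orth: "e n \<in> orthant" "y \<in> orthant" for n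
    by (auto simp: orthant_def e_def add_nonneg_nonneg)
  have "e \<longlonglongrightarrow> y"
  proof (rule vec_tendstoI)
    fix i
    have "(\<lambda>n. y $ i + 1 / real (Suc n)) \<longlonglongrightarrow> y $ i + 0"
      by (intro tendsto_intros LIMSEQ_Suc lim_1_over_n)
    then show "(\<lambda>n. e n $ i) \<longlonglongrightarrow> y $ i" by (simp add: e_def)
  qed
  then have "(\<lambda>n. r * g (e n)) \<longlonglongrightarrow> r * g y"
    using orth by (intro tendsto_mult_left continuous_on_tendsto_compose[OF cont]) auto
  then have "eventually (\<lambda>n. r * g (e n) < 1) sequentially"
    using r(2) by (rule order_tendstoD)
  then obtain n where n: "r * g (e n) < 1"
    by (auto simp: eventually_sequentially)
  have e_pos: "0 < e n $ j" for j
    using y_nn[of j] by (simp add: e_def add_nonneg_pos)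
  then have "e n \<noteq> 0" by (metis zero_index order_less_irrefl)
  then have ge: "0 < g (e n)" using orth by (intro pos)
  define z where "z = inverse (g (e n)) *\<^sub>R e n"
  have "z \<in> orthant" using orth(1)[of n] ge by (auto simp: z_def orthant_def)
  moreover have "g z = 1" using homogeneous[OF orth(1), of "inverse (g (e n))" n] ge by (simp add: z_def)
  ultimately have "z \<in> G" by (simp add: mem_iff)
  moreover have "r * w $ j / vec_max w < z $ j" for j
  proof -
    \<comment> \<open>This is only a weak inequality, since \<open>w $ j\<close> may be 0;
      strictness comes from the added \<open>1 / real (Suc n)\<close>.\<close>
    have "r * g (e n) * (w $ j / vec_max w) \<le> 1 * (w $ j / vec_max w)"
      using n u[of j] by (intro mult_right_mono) auto
    also have "\<dots> < e n $ j" using y_ge[of j] by (simp add: e_def) (smt (verit) divide_pos_pos of_nat_0_le_iff)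
    finally show ?thesis using ge by (simp add: z_def field_simps)
  qed
  ultimately show ?thesis by blast
qed

text \<open>The minimum is attained because the intervals of \<open>scaled_R\<close> are open: at
  the critical radius every point above the corner has gauge strictly over 1. The bound
  \<open>1 <= g y\<close> keeps that radius in \<open>[0, 1]\<close>.\<close>

lemma minimum_avoiding_radii:
  assumes w: "w \<in> sum_simplex" and y: "y \<in> B_set w" "\<And>z. z \<in> B_set w \<Longrightarrow> g y \<le> g z"
    and "1 \<le> g y"
  shows "has_minimum (avoiding_radii G w)" "minimum (avoiding_radii G w) = inverse (g y)"
proof -
  have mem: "r \<in> avoiding_radii G w \<longleftrightarrow> 0 \<le> r \<and> r \<le> 1 \<and> (\<forall>x\<in>G. \<exists>j. x $ j \<le> r * w $ j / vec_max w)" for r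
  proof -
    have "scaled_R r w \<inter> ereal_vec ` G = {} \<longleftrightarrow> (\<forall>x\<in>G. ereal_vec x \<notin> scaled_R r w)" by blast
    then show ?thesis by (simp add: avoiding_radii_def scaled_R_def ereal_vec_def not_less)
  qed
  have in_radii: "inverse (g y) \<in> avoiding_radii G w"
    unfolding mem
  proof (intro conjI ballI)
    fix x assume "x \<in> G"
    show "\<exists>j. x $ j \<le> inverse (g y) * w $ j / vec_max w"
    proof (rule ccontr)
      assume "\<nexists>j. x $ j \<le> inverse (g y) * w $ j / vec_max w"
      then have "\<And>j. inverse (g y) * w $ j / vec_max w < x $ j" by (simp only: not_le not_ex)
      from exceeds_radius(2)[OF w y(2) _ _ this] have "inverse (g y) * g y < g x"
        using \<open>1 \<le> g y\<close> by simp
      then show False using \<open>1 \<le> g y\<close> \<open>x \<in> G\<close> by (simp add: mem_iff)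
    qed
  qed (use \<open>1 \<le> g y\<close> in \<open>auto simp: field_simps\<close>)
  have lower: "inverse (g y) \<le> r" if r: "r \<in> avoiding_radii G w" for r
  proof (rule ccontr)
    assume "\<not> inverse (g y) \<le> r"
    then have "r * g y < 1" using \<open>1 \<le> g y\<close> by (simp add: field_simps)
    then obtain z where "z \<in> G" "\<And>j. r * w $ j / vec_max w < z $ j"
      using exists_above_radius[OF w y(1), of r] r unfolding mem by blast
    moreover from this(1) r obtain j where "z $ j \<le> r * w $ j / vec_max w"
      unfolding mem by blast
    ultimately show False using not_le by blast
  qed
  show "has_minimum (avoiding_radii G w)" "minimum (avoiding_radii G w) = inverse (g y)"
    using minimum_eqI[of "inverse (g y)", OF in_radii lower] by auto
qed

end

text \<open>Continuity at 0 makes the gauge finite, boundedness of \<open>G\<close> makes it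
  positive away from 0, and homogeneity comes from scaling the admissible \<open>t\<close>.\<close>

lemma gauge_body_of_gauge_fun:
  fixes G :: "(real ^ 'd) set"
  assumes "compact G" "G \<noteq> {}" and G: "G = {x \<in> orthant. gauge_fun G x \<le> 1}"
    and cont: "continuous_on orthant (gauge_fun G)"
  obtains g where "gauge_body G g" "\<And>x. x \<in> orthant \<Longrightarrow> gauge_fun G x = ereal (g x)"
proof -
  define S where "S x = {t::real. 0 \<le> t \<and> x \<in> (\<lambda>y. t *\<^sub>R y) ` G}" for x
  define g where "g x = Inf (S x)" for x
  have bdd: "bdd_below (S x)" for x by (intro bdd_belowI[of _ 0]) (simp add: S_def)
  have S_mem: "t \<in> S x" if "0 < t" "inverse t *\<^sub>R x \<in> G" for t x
    using that unfolding S_def by (auto intro!: image_eqI[of _ _ "inverse t *\<^sub>R x"])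
  have zero: "gauge_fun G 0 = 0"
  proof (rule antisym)
    \<comment> \<open>Any \<open>y\<close> in \<open>G\<close> satisfies \<open>0 = 0 *R y\<close>,
      so the value \<open>t = 0\<close> is admissible.\<close>
    have "0 \<in> S 0" using \<open>G \<noteq> {}\<close> by (auto simp: S_def)
    then show "gauge_fun G 0 \<le> 0"
      unfolding gauge_fun_def S_def[symmetric] by (auto intro: INF_lower2)
    show "0 \<le> gauge_fun G 0"
      unfolding gauge_fun_def by (auto intro: INF_greatest)
  qed
  \<comment> \<open>Continuity at \<open>0\<close> places a neighbourhood of \<open>0\<close> inside \<open>G\<close>, so the gauge is finite.\<close>
  have ne: "S x \<noteq> {}" if x: "x \<in> orthant" for x
  proof -
    have orth: "inverse (real (Suc n)) *\<^sub>R x \<in> orthant" for n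
      using x by (simp add: orthant_def del: of_nat_Suc)
    have "(\<lambda>n. inverse (real (Suc n)) *\<^sub>R x) \<longlonglongrightarrow> 0 *\<^sub>R x"
      by (intro tendsto_intros LIMSEQ_inverse_real_of_nat)
    then have "(\<lambda>n. gauge_fun G (inverse (real (Suc n)) *\<^sub>R x)) \<longlonglongrightarrow> gauge_fun G 0"
      using orth by (intro continuous_on_tendsto_compose[OF cont]) (auto simp: orthant_def)
    then have "eventually (\<lambda>n. gauge_fun G (inverse (real (Suc n)) *\<^sub>R x) < 1) sequentially"
      unfolding zero by (rule order_tendstoD) simp
    then obtain n where "gauge_fun G (inverse (real (Suc n)) *\<^sub>R x) < 1"
      by (auto simp: eventually_sequentially simp del: of_nat_Suc)
    then have "inverse (real (Suc n)) *\<^sub>R x \<in> G" using orth[of n] by (subst G) auto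
    then show ?thesis using S_mem[of "real (Suc n)" x] by auto
  qed
  have gauge: "gauge_fun G x = ereal (g x)" if "x \<in> orthant" for x
    unfolding gauge_fun_def S_def[symmetric] g_def using ereal_Inf'[OF bdd ne[OF that]] by simp
  have scale_le: "g (t *\<^sub>R x) \<le> t * g x" if x: "x \<in> orthant" and t: "0 < t" for x t
  proof -
    have "inverse t * g (t *\<^sub>R x) \<le> s" if s: "s \<in> S x" for s
    proof -
      have "t * s \<in> S (t *\<^sub>R x)" using s t by (auto simp: S_def)
      then have "g (t *\<^sub>R x) \<le> t * s" unfolding g_def by (intro cInf_lower bdd)
      then show ?thesis using t by (simp add: field_simps)
    qed
    then have "inverse t * g (t *\<^sub>R x) \<le> g x" unfolding g_def[of x] by (intro cInf_greatest ne x)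
    then show ?thesis using t by (simp add: field_simps)
  qed
  have "gauge_body G g"
  proof
    show "x \<in> G \<longleftrightarrow> x \<in> orthant \<and> g x \<le> 1" for x
      using gauge[of x] by (subst G) auto
    show "g (t *\<^sub>R x) = t * g x" if "x \<in> orthant" "0 < t" for x t
    proof (rule antisym)
      show "g (t *\<^sub>R x) \<le> t * g x" using scale_le that by simp
      have "t *\<^sub>R x \<in> orthant" using that by (simp add: orthant_def)
      \<comment> \<open>Scaling back by \<open>inverse t\<close> turns the one-sided bound into its
        converse.\<close>
      from scale_le[OF this, of "inverse t"] show "t * g x \<le> g (t *\<^sub>R x)"
        using that by (simp add: field_simps)
    qed
    obtain K where K: "0 < K" "\<And>y. y \<in> G \<Longrightarrow> norm y \<le> K"
      using compact_imp_bounded[OF \<open>compact G\<close>] by (auto simp: bounded_pos)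
    show "0 < g x" if x: "x \<in> orthant" "x \<noteq> 0" for x
    proof -
      have "norm x / K \<le> s" if s: "s \<in> S x" for s
      proof -
        obtain y where "y \<in> G" "x = s *\<^sub>R y" "0 \<le> s" using s by (auto simp: S_def)
        then have "norm x \<le> s * K" using K(2)[of y] by (simp add: mult_left_mono)
        then show ?thesis using K(1) by (simp add: field_simps)
      qed
      then have "norm x / K \<le> g x" unfolding g_def by (intro cInf_greatest ne x)
      moreover have "0 < norm x / K" using x K by simp
      ultimately show ?thesis by linarith
    qed
    have "continuous_on orthant (\<lambda>x. real_of_ereal (gauge_fun G x))"
      using cont continuous_on_iff_real[of orthant "gauge_fun G"] gauge by (simp add: comp_def)
    then show "continuous_on orthant g" using gauge by (simp cong: continuous_on_cong)
  qed fact
  then show thesis using gauge by (rule that)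
qed

section \<open>The tail rate\<close>

lemma axis_in_sum_simplex:
  "(axis k 1 :: real ^ 'd) \<in> sum_simplex" "vec_max (axis k 1 :: real ^ 'd) = 1"
proof -
  show "(axis k 1 :: real ^ 'd) \<in> sum_simplex"
    by (simp add: sum_simplex_def axis_def)
  show "vec_max (axis k 1 :: real ^ 'd) = 1"
    unfolding vec_max_def by (rule Max_eqI) (auto simp: axis_def image_iff)
qed

text \<open>The standing assumptions, with the extended gauge already replaced by the real
  \<open>g\<close>.\<close>

locale light_tailed_cloud = prob_space M + gauge_body G g
  for M :: "'s measure" and G :: "(real ^ 'd) set" and g +
  fixes X :: "'s \<Rightarrow> real ^ 'd" and Xs :: "nat \<Rightarrow> 's \<Rightarrow> real ^ 'd"
    and ell :: "real \<Rightarrow> real ^ 'd \<Rightarrow> real" and lam :: "real ^ 'd \<Rightarrow> real"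
  assumes X [measurable]: "X \<in> borel_measurable M"
    and margins: "distributed M lborel (\<lambda>s. X s $ j) (\<lambda>x. ennreal (exponential_density 1 x))"
    and indep: "indep_vars (\<lambda>_. borel) Xs {1..}"
    and copies: "1 \<le> i \<Longrightarrow> distr M borel (Xs i) = distr M borel X"
    and nonempty: "G \<noteq> {}"
    and conv: "converges_in_prob_onto M (sample_cloud Xs) G"
    and slow: "w \<in> sum_simplex \<Longrightarrow> slowly_varying (\<lambda>t. ell t w)"
    and lam_nonneg: "w \<in> sum_simplex \<Longrightarrow> 0 \<le> lam w"
    and tail: "w \<in> sum_simplex \<Longrightarrow> 0 \<le> v \<Longrightarrow>
      prob {s \<in> space M. \<forall>j. w $ j * v < X s $ j} = ell (exp v) w * exp (- lam w * v)"
begin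

lemma event_upper_orthant: "{s \<in> space M. \<forall>j. a j < X s $ j} \<in> events"
proof -
  have "X -` {x. \<forall>j. a j < x $ j} \<inter> space M \<in> events"
    by (intro measurable_sets[OF X] borel_open open_upper_orthant)
  then show ?thesis by (simp add: vimage_def Int_def conj_commute)
qed

lemma Xs_measurable: "1 \<le> i \<Longrightarrow> random_variable borel (Xs i)"
  using indep by (simp add: indep_vars_def)

sublocale cloud: limit_cloud M "\<lambda>n i s. Xs i s /\<^sub>R ln (real n)" G
proof
  show "random_variable borel (\<lambda>s. Xs i s /\<^sub>R ln (real n))" if "1 \<le> i" for n i
    using Xs_measurable[OF that] by measurable
  show "converges_in_prob_onto M (\<lambda>n s. (\<lambda>i. Xs i s /\<^sub>R ln (real n)) ` {1..n}) G"
    using conv by (simp add: sample_cloud_def[abs_def])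
qed (fact compact_G nonempty)+

abbreviation survival :: "real ^ 'd \<Rightarrow> real \<Rightarrow> real" where
  "survival w v \<equiv> prob {s \<in> space M. \<forall>j. w $ j * v < X s $ j}"

lemma regularly_varying_survival:
  assumes w: "w \<in> sum_simplex"
  shows "regularly_varying_tail (survival w) (\<lambda>t. ell t w) (lam w)"
proof
  fix u v :: real assume "0 \<le> u" "u \<le> v"
  then have "w $ j * u \<le> w $ j * v" for j
    using sum_simplexD(1)[OF w] by (intro mult_left_mono) auto
  then show "survival w v \<le> survival w u"
    by (intro finite_measure_mono event_upper_orthant) (auto intro: le_less_trans)
qed (use slow tail w in auto)

lemma mass_of_scaled_orthant:
  assumes w: "w \<in> sum_simplex"
  shows "eventually (\<lambda>n. \<forall>i\<in>{1..n}.
    prob {s \<in> space M. Xs i s /\<^sub>R ln (real n) \<in> {x. \<forall>j. r * w $ j / vec_max w < x $ j}} =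
      survival w (r / vec_max w * ln (real n))) sequentially"
  \<comment> \<open>From \<open>n = 2\<close> on, \<open>ln n\<close> is positive and the scaling
    preserves strict inequalities.\<close>
  using eventually_ge_at_top[of 2]
proof eventually_elim
  case (elim n)
  have ln: "0 < ln (real n)" using elim by simp
  define a where "a j = w $ j * (r / vec_max w * ln (real n))" for j
  have *: "r * w $ j / vec_max w < (x /\<^sub>R ln (real n)) $ j \<longleftrightarrow> a j < x $ j" for x j
  proof -
    have "r * w $ j / vec_max w < (x /\<^sub>R ln (real n)) $ j \<longleftrightarrow>
        r * w $ j / vec_max w < x $ j / ln (real n)"
      by (simp add: divide_inverse mult.commute)
    also have "\<dots> \<longleftrightarrow> r * w $ j / vec_max w * ln (real n) < x $ j"
      using ln by (simp only: pos_less_divide_eq)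
    finally show ?thesis by (simp add: a_def mult_ac)
  qed
  show ?case
  proof
    fix i assume "i \<in> {1..n}"
    then have i: "1 \<le> i" by simp
    let ?A = "{x :: real ^ 'd. \<forall>j. a j < x $ j}"
    have A: "?A \<in> sets borel" by (intro borel_open open_upper_orthant)
    have "prob {s \<in> space M. \<forall>j. a j < Xs i s $ j} = measure (distr M borel (Xs i)) ?A"
      using measure_distr[OF Xs_measurable[OF i] A]
      by (simp add: vimage_def Int_def conj_commute)
    also have "\<dots> = measure (distr M borel X) ?A" by (simp only: copies[OF i])
    also have "\<dots> = prob {s \<in> space M. \<forall>j. a j < X s $ j}"
      using measure_distr[OF X A] by (simp add: vimage_def Int_def conj_commute)
    finally show "prob {s \<in> space M. Xs i s /\<^sub>R ln (real n) \<in> {x. \<forall>j. r * w $ j / vec_max w < x $ j}} =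
        survival w (r / vec_max w * ln (real n))"
      by (simp only: mem_Collect_eq * a_def)
  qed
qed

text \<open>Otherwise some \<open>b\<close> lies between \<open>g y\<close> and
  \<open>lam w / vec_max w\<close>. For \<open>r = 1 / b\<close> the open orthant of radius
  \<open>r\<close> contains a point of \<open>G\<close>, so the cloud's hitting mass forces
  \<open>lam w * r <= vec_max w\<close>, against the choice of \<open>b\<close>.\<close>

lemma rate_le:
  assumes w: "w \<in> sum_simplex" and y: "y \<in> B_set w" "0 < g y"
  shows "lam w \<le> vec_max w * g y"
proof (rule ccontr)
  interpret regularly_varying_tail "survival w" "\<lambda>t. ell t w" "lam w"
    by (rule regularly_varying_survival[OF w])
  note m = sum_simplexD(3)[OF w]
  assume "\<not> lam w \<le> vec_max w * g y"
  then have "g y < lam w / vec_max w" using m by (simp add: field_simps)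
  then obtain b where b: "g y < b" "b < lam w / vec_max w" using dense by blast
  define r where "r = inverse b"
  have r: "0 < r" "r * g y < 1" using b(1) y(2) by (simp_all add: r_def field_simps)
  obtain z where z: "z \<in> G" "\<And>j. r * w $ j / vec_max w < z $ j"
    using exists_above_radius[OF w y(1), of r] r by auto
  have "eventually (\<lambda>n. 1 / 2 \<le> real n * survival w (r / vec_max w * ln (real n))) sequentially"
    using z by (intro cloud.mass_near_limit_point[OF z(1) _ open_upper_orthant mass_of_scaled_orthant[OF w]]) simp
  then have "lam w * (r / vec_max w) \<le> 1"
    using r(1) m by (intro rate_le_one) auto
  moreover have "1 < lam w / vec_max w * r"
    using b y(2) m by (simp add: r_def field_simps)
  ultimately show False by simp
qed

text \<open>Otherwise \<open>r = 1 / b\<close> with \<open>b\<close> between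
  \<open>lam w / vec_max w\<close> and \<open>c\<close> has \<open>r * c > 1\<close>. The closed
  orthant of radius \<open>r\<close> is then disjoint from the compact \<open>G\<close>, hence at
  positive distance, and the bounded mass forces \<open>lam w * r >= vec_max w\<close>.\<close>

lemma rate_ge:
  assumes w: "w \<in> sum_simplex" and c: "0 < c" "\<And>z. z \<in> B_set w \<Longrightarrow> c \<le> g z"
  shows "vec_max w * c \<le> lam w"
proof (rule ccontr)
  interpret regularly_varying_tail "survival w" "\<lambda>t. ell t w" "lam w"
    by (rule regularly_varying_survival[OF w])
  note m = sum_simplexD(3)[OF w]
  assume "\<not> vec_max w * c \<le> lam w"
  then have "lam w / vec_max w < c" using m by (simp add: field_simps)
  then obtain b where b: "lam w / vec_max w < b" "b < c" using dense by blast
  have "0 \<le> lam w / vec_max w" using lam_nonneg[OF w] m by simp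
  then have b_pos: "0 < b" using b(1) by linarith
  define r where "r = inverse b"
  have r: "0 < r" "1 < r * c" using b(2) b_pos by (simp_all add: r_def field_simps)
  let ?A = "{x :: real ^ 'd. \<forall>j. r * w $ j / vec_max w < x $ j}"
  let ?C = "{x :: real ^ 'd. \<forall>j. r * w $ j / vec_max w \<le> x $ j}"
  have "x \<notin> G" if "x \<in> ?C" for x
    using exceeds_radius(1)[OF w c(2) c(1) r(1), of x] that r(2) by (auto simp: mem_iff)
  \<comment> \<open>\<open>setdist\<close> is 0 if one of the sets is empty, so both have to be
    shown non-empty.\<close>
  moreover have "(\<chi> j. r * w $ j / vec_max w) \<in> ?C" by simp
  ultimately have "setdist ?C G \<noteq> 0"
    using setdist_eq_0_closed_compact[OF closed_upper_orthant compact_G, of "\<lambda>j. r * w $ j / vec_max w"] nonempty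
    by blast
  then have d: "0 < setdist ?C G" using setdist_pos_le[of ?C G] by linarith
  \<comment> \<open>Halving the distance gives the strict inequality required of
    \<open>e\<close>.\<close>
  have "setdist ?C G / 2 < infdist x G" if "x \<in> ?A" for x
  proof -
    have "x \<in> ?C" using that by (auto intro: less_imp_le)
    then have "setdist ?C G \<le> infdist x G"
      unfolding infdist_eq_setdist by (rule setdist_le_sing)
    then show ?thesis using d by linarith
  qed
  moreover have "indep_vars (\<lambda>_. borel) (\<lambda>i s. Xs i s /\<^sub>R ln (real n)) {1..}" for n
    by (rule indep_vars_compose2[OF indep]) simp
  ultimately have "eventually (\<lambda>n. real n * survival w (r / vec_max w * ln (real n)) \<le> 1) sequentially"
    using d by (intro cloud.mass_away_from_limit_set[OF _ _ _ _ mass_of_scaled_orthant[OF w, of r],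
          where e = "setdist ?C G / 2"] borel_open open_upper_orthant) auto
  then have "1 \<le> lam w * (r / vec_max w)"
    using r(1) m by (intro rate_ge_one) auto
  moreover have "lam w / vec_max w * r < 1"
    using b(1) b_pos m by (simp add: r_def field_simps)
  ultimately show False by simp
qed

text \<open>For a unit vector \<open>w\<close> the survival function is at most that of an exponential margin. Together with
  the upper bound on the rate this yields \<open>x\<^sub>k \<le> g x\<close>, hence \<open>r_min G w \<le> 1\<close>.\<close>

lemma rate_axis_ge: "1 \<le> lam (axis k 1)"
proof -
  let ?w = "axis k 1 :: real ^ 'd"
  interpret regularly_varying_tail "survival ?w" "\<lambda>t. ell t ?w" "lam ?w"
    by (rule regularly_varying_survival[OF axis_in_sum_simplex(1)])
  have "eventually (\<lambda>n. real n * survival ?w (1 * ln (real n)) \<le> 1) sequentially"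
    using eventually_ge_at_top[of 1]
  proof eventually_elim
    case (elim n)
    have "(\<lambda>s. X s $ k) \<in> borel_measurable M"
      using distributed_measurable[OF margins[of k]] by simp
    then have "{s \<in> space M. ln (real n) < X s $ k} \<in> events" by measurable
    \<comment> \<open>Only the condition on coordinate \<open>k\<close> is kept; its exponential
      tail at \<open>ln n\<close> is exactly \<open>1 / n\<close>.\<close>
    moreover have "{s \<in> space M. \<forall>j. ?w $ j * ln (real n) < X s $ j} \<subseteq> {s \<in> space M. ln (real n) < X s $ k}"
      by (auto simp: axis_def split: if_splits)
    ultimately have "survival ?w (ln (real n)) \<le> prob {s \<in> space M. ln (real n) < X s $ k}"
      by (intro finite_measure_mono)
    also have "\<dots> = exp (- ln (real n) * 1)"
      using elim by (intro exponential_distributedD_gt[OF margins]) auto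
    also have "\<dots> = 1 / real n" using elim by (simp add: exp_minus divide_inverse)
    finally show ?case using elim by (simp add: field_simps)
  qed
  from rate_ge_one[OF _ this] show ?thesis by simp
qed

text \<open>Where \<open>w\<close> is maximal, \<open>y $ k >= 1\<close>, and dividing
  \<open>y\<close> by \<open>y $ k\<close> lands in the set belonging to the unit vector
  \<open>axis k 1\<close>. There the minimal gauge is at least the rate, which is at least 1;
  homogeneity gives \<open>g y >= y $ k\<close>.\<close>

lemma gauge_ge_one:
  assumes w: "w \<in> sum_simplex" and y: "y \<in> B_set w"
  shows "1 \<le> g y"
proof -
  note w' = sum_simplexD[OF w]
  obtain k where k: "w $ k = vec_max w" using w'(4) by blast
  have y_ge: "w $ j / vec_max w \<le> y $ j" for j using y mem_B_set_iff[OF w] by blast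
  then have yk: "1 \<le> y $ k" using k w'(3) by (metis divide_self less_irrefl)
  have "0 \<le> w $ j / vec_max w" for j using w'(1,3) by (simp add: less_imp_le)
  then have nn: "0 \<le> y $ j" for j using y_ge order_trans by blast
  have "inverse (y $ k) *\<^sub>R y \<in> B_set (axis k 1)"
    unfolding mem_B_set_iff[OF axis_in_sum_simplex(1)] axis_in_sum_simplex(2)
    using nn yk by (auto simp: axis_def)
  moreover obtain y' where y': "y' \<in> B_set (axis k 1)" "\<And>z. z \<in> B_set (axis k 1) \<Longrightarrow> g y' \<le> g z" "0 < g y'"
    using obtains_minimizer[OF axis_in_sum_simplex(1)] by blast
  ultimately have "g y' \<le> g (inverse (y $ k) *\<^sub>R y)" by blast
  moreover have "1 \<le> g y'"
    using rate_axis_ge[of k] rate_le[OF axis_in_sum_simplex(1) y'(1,3)] by (simp add: axis_in_sum_simplex)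
  moreover have "g (inverse (y $ k) *\<^sub>R y) = inverse (y $ k) * g y"
    using nn yk by (intro homogeneous) (auto simp: orthant_def)
  ultimately have "1 \<le> inverse (y $ k) * g y" by linarith
  then have "y $ k \<le> g y" using yk by (simp add: field_simps)
  then show ?thesis using yk by linarith
qed

end

text \<open>\<open>minimum\<close> is informative only where a minimum exists, hence the two
  \<open>has_minimum\<close> conjuncts. The equations are stated in \<open>ereal\<close> because
  \<open>gauge_fun\<close> takes its values there.\<close>

theorem proposition8:
  fixes M :: "'s measure"
    and X :: "'s \<Rightarrow> real ^ 'd"
    and Xs :: "nat \<Rightarrow> 's \<Rightarrow> real ^ 'd"
    and G :: "(real ^ 'd) set"
    and ell :: "real \<Rightarrow> real ^ 'd \<Rightarrow> real"
    and lam :: "real ^ 'd \<Rightarrow> real"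
  assumes "prob_space M"
    and "X \<in> borel_measurable M"
    and "\<forall>s\<in>space M. X s \<in> orthant"
    and "\<forall>j. distributed M lborel (\<lambda>s. X s $ j) (\<lambda>x. ennreal (exponential_density 1 x))"
    and "prob_space.indep_vars M (\<lambda>_. borel) Xs {1..}"
    and "\<forall>i\<ge>1. distr M borel (Xs i) = distr M borel X"
    and "compact G" and "G \<noteq> {}"
    and "G = {x \<in> orthant. gauge_fun G x \<le> 1}"
    and "continuous_on orthant (gauge_fun G)"
    and "converges_in_prob_onto M (sample_cloud Xs) G"
    and "\<forall>w\<in>sum_simplex. slowly_varying (\<lambda>t. ell t w) \<and> 0 \<le> lam w \<and>
           (\<forall>v\<ge>0. measure M {s \<in> space M. \<forall>j. w $ j * v < X s $ j}
                      = ell (exp v) w * exp (- (lam w) * v))"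
  shows "\<forall>w\<in>sum_simplex.
           has_minimum (avoiding_radii G w) \<and>
           has_minimum (gauge_fun G ` B_set w) \<and>
           ereal (r_min G w) = inverse (minimum (gauge_fun G ` B_set w)) \<and>
           ereal (lam w) = ereal (vec_max w) * minimum (gauge_fun G ` B_set w)"
proof
  fix w :: "real ^ 'd" assume w: "w \<in> sum_simplex"
  obtain g where g: "gauge_body G g" "\<And>x. x \<in> orthant \<Longrightarrow> gauge_fun G x = ereal (g x)"
    using gauge_body_of_gauge_fun[OF assms(7-10)] by blast
  interpret light_tailed_cloud M G g X Xs ell lam
    unfolding light_tailed_cloud_def light_tailed_cloud_axioms_def
    using assms g(1) by blast
  obtain y where y: "y \<in> B_set w" "\<And>z. z \<in> B_set w \<Longrightarrow> g y \<le> g z" "0 < g y"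
    using obtains_minimizer[OF w] by blast
  have ge1: "1 \<le> g y" by (rule gauge_ge_one[OF w y(1)])
  have gauge: "gauge_fun G z = ereal (g z)" if "z \<in> B_set w" for z
    using that by (intro g(2)) (auto simp: B_set_def)
  have gauge_min: "has_minimum (gauge_fun G ` B_set w)"
      "minimum (gauge_fun G ` B_set w) = ereal (g y)"
    using y gauge by (auto intro!: minimum_eqI image_eqI[of _ _ y])
  \<comment> \<open>The minimizer \<open>y\<close> serves both bounds: as a single point for the
    upper one, through its minimality for the lower one.\<close>
  have "lam w = vec_max w * g y"
    using rate_le[OF w y(1,3)] rate_ge[OF w y(3,2)] by simp
  moreover have "r_min G w = inverse (g y)"
    using minimum_avoiding_radii(2)[OF w y(1,2) ge1] by (simp add: r_min_def)
  ultimately show "has_minimum (avoiding_radii G w) \<and>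
           has_minimum (gauge_fun G ` B_set w) \<and>
           ereal (r_min G w) = inverse (minimum (gauge_fun G ` B_set w)) \<and>
           ereal (lam w) = ereal (vec_max w) * minimum (gauge_fun G ` B_set w)"
    using minimum_avoiding_radii(1)[OF w y(1,2) ge1] gauge_min ge1 by simp
qed

end
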